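(* Let $M\ge 3$ be an integer and assume $\sigma(A,\cdot)$ can be evaluated exactly. The following algorithm for CostIMA returns a feasible solution $S_{out}$ with $\sigma(A,S_{out})\ge\left(1-\frac1e\right)\mathrm{OPT}$, where $\mathrm{OPT}$ is the optimal value. Algorithm: let $S_1$ maximize $\sigma(A,S)$ over all $S\subseteq (A\times V)\setminus E$ with $|S|<M$ and $c(S)\le k$. For every $S\subseteq (A\times V)\setminus E$ with $|S|=M$ and $c(S)\le k$, complete $S$ by the greedy phase: with remaining budget $k-c(S)$ and candidate set $T=((A\times V)\setminus E)\setminus S$, while $T\neq\emptyset$, pick $\hat e\in T$ maximizing $\delta(S\cup\{e\},S)/c_e$; if $c_{\hat e}$ is at most the remaining budget, add $\hat e$ to $S$ and decrease the remaining budget by $c_{\hat e}$; remove $\hat e$ from $T$. Let $S_2$ be the completed set with the largest $\sigma(A,\cdot)$. Return whichever of $S_1,S_2$ has larger $\sigma(A,\cdot)$.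
   Context: A network is a directed graph $G=(V,E)$ with propagation probabilities $p:V\times V\to[0,1]$ and edge-addition costs $c:V\times V\to[0,1]$. Independent Cascade Model: given a seed set $A\subseteq V$, the nodes of $A$ are active initially; each node $u$ that has just become active gets one chance to activate each inactive out-neighbour $v$, succeeding independently with probability $p_{(u,v)}$; the process stops when no new node becomes active. For $S\subseteq (V\times V)\setminus E$, $G(S)=(V,E\cup S)$ and $\sigma(A,S)$ is the expected number of active nodes at the end of the process on $G(S)$ with seeds $A$. For $S_2\subseteq S_1$, $\delta(S_1,S_2)$ is the expected number of nodes reachable from $A$ via live edges in a random live-edge graph of $G(S_1)$ but not reachable once the edges of $S_1\setminus S_2$ are removed (each edge live independently with probability $p_e$). CostIMA: given $G,p,c$, a seed set $A\subseteq V$ and a budget $k$, find $S\subseteq (A\times V)\setminus E$ with $c(S)=\sum_{e\in S}c_e\le k$ maximizing $\sigma(A,S)$; $\mathrm{OPT}$ denotes the maximum. *)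

theory Defs
  imports "HOL-Probability.Probability" "HOL-Probability.Product_PMF"
begin

type_synonym 'v edge = "'v \<times> 'v"

text \<open>
  A state is a pair \<open>(X, N)\<close> of the set \<open>X\<close> of active nodes and the set \<open>N \<subseteq> X\<close> of nodes that
  became active in the preceding round. In one round every \<open>u \<in> N\<close> makes one independent attempt on
  every out-neighbour outside \<open>X\<close>. For \<open>N = {}\<close> a round changes nothing: the process has stopped.
\<close>

definition ic_round ::
  "'v edge set \<Rightarrow> ('v edge \<Rightarrow> real) \<Rightarrow> 'v set \<times> 'v set \<Rightarrow> ('v set \<times> 'v set) pmf" where
  "ic_round F p = (\<lambda>(X, N).
     let T = {(u, v) \<in> F. u \<in> N \<and> v \<notin> X} in
     map_pmf (\<lambda>succ. let N' = {v. \<exists>u. (u, v) \<in> T \<and> succ (u, v)} in (X \<union> N', N'))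
       (Pi_pmf T False (\<lambda>e. bernoulli_pmf (p e))))"

fun ic_state ::
  "'v edge set \<Rightarrow> ('v edge \<Rightarrow> real) \<Rightarrow> 'v set \<Rightarrow> nat \<Rightarrow> ('v set \<times> 'v set) pmf" where
  "ic_state F p A 0 = return_pmf (A, A)"
| "ic_state F p A (Suc n) = bind_pmf (ic_state F p A n) (ic_round F p)"

text \<open>
  Every round but the last activates a new node, so the process has stopped after \<open>card V\<close> rounds;
  this is the lemma \<open>ic_state_stopped\<close> below.
\<close>

definition ic_final :: "'v set \<Rightarrow> 'v edge set \<Rightarrow> ('v edge \<Rightarrow> real) \<Rightarrow> 'v set \<Rightarrow> 'v set pmf" where
  "ic_final V F p A = map_pmf fst (ic_state F p A (card V))"

lemma ic_round_cases:
  assumes "(X', N') \<in> set_pmf (ic_round F p (X, N))"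
  shows "X' = X \<union> N'" "N' \<inter> X = {}" "N' \<subseteq> snd ` F" "N = {} \<Longrightarrow> N' = {}"
  using assms by (force simp: ic_round_def Let_def)+

lemma ic_state_invariant:
  assumes "finite V" "F \<subseteq> V \<times> V" "A \<subseteq> V" "(X, N) \<in> set_pmf (ic_state F p A n)"
  shows "X \<subseteq> V \<and> (N = {} \<or> n < card X)"
  using assms(4)
proof (induction n arbitrary: X N)
  case 0
  then show ?case
    using assms(1,3) by (auto simp: card_gt_0_iff dest: finite_subset)
next
  case (Suc n)
  then obtain X0 N0 where prev: "(X0, N0) \<in> set_pmf (ic_state F p A n)"
    and step: "(X, N) \<in> set_pmf (ic_round F p (X0, N0))"
    by auto
  note r = ic_round_cases[OF step]
  have IH: "X0 \<subseteq> V" "N0 = {} \<or> n < card X0"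
    using Suc.IH[OF prev] by auto
  have "N \<subseteq> V" using r(3) assms(2) by fastforce
  with IH(1) r(1) have sub: "X \<subseteq> V" by simp
  have "Suc n < card X" if "N \<noteq> {}"
  proof -
    have "X0 \<subset> X" using r(1,2) that by blast
    then have "card X0 < card X"
      using sub assms(1) by (meson finite_subset psubset_card_mono)
    moreover have "n < card X0" using IH(2) r(4) that by blast
    ultimately show ?thesis by simp
  qed
  then show ?case using sub by blast
qed

lemma ic_state_stopped:
  assumes "finite V" "F \<subseteq> V \<times> V" "A \<subseteq> V" "(X, N) \<in> set_pmf (ic_state F p A (card V))"
  shows "N = {}"
  using ic_state_invariant[OF assms] card_mono[OF assms(1), of X] by auto

definition ic_sigma ::
  "'v set \<Rightarrow> 'v edge set \<Rightarrow> ('v edge \<Rightarrow> real) \<Rightarrow> 'v set \<Rightarrow> 'v edge set \<Rightarrow> real" where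
  "ic_sigma V E p A S = measure_pmf.expectation (ic_final V (E \<union> S) p A) (\<lambda>X. real (card X))"

definition live_edges :: "'v edge set \<Rightarrow> ('v edge \<Rightarrow> real) \<Rightarrow> 'v edge set pmf" where
  "live_edges F p = map_pmf (\<lambda>live. {e \<in> F. live e}) (Pi_pmf F False (\<lambda>e. bernoulli_pmf (p e)))"

definition delta ::
  "'v edge set \<Rightarrow> ('v edge \<Rightarrow> real) \<Rightarrow> 'v set \<Rightarrow> 'v edge set \<Rightarrow> 'v edge set \<Rightarrow> real" where
  "delta E p A S1 S2 = measure_pmf.expectation (live_edges (E \<union> S1) p)
     (\<lambda>L. real (card (L\<^sup>* `` A - (L - (S1 - S2))\<^sup>* `` A)))"

definition candidates :: "'v set \<Rightarrow> 'v edge set \<Rightarrow> 'v set \<Rightarrow> 'v edge set" where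
  "candidates V E A = (A \<times> V) - E"

definition feasible ::
  "'v set \<Rightarrow> 'v edge set \<Rightarrow> ('v edge \<Rightarrow> real) \<Rightarrow> 'v set \<Rightarrow> real \<Rightarrow> 'v edge set \<Rightarrow> bool" where
  "feasible V E c A k S \<longleftrightarrow> S \<subseteq> candidates V E A \<and> sum c S \<le> k"

definition costima_opt ::
  "'v set \<Rightarrow> 'v edge set \<Rightarrow> ('v edge \<Rightarrow> real) \<Rightarrow> ('v edge \<Rightarrow> real) \<Rightarrow> 'v set \<Rightarrow> real \<Rightarrow> real" where
  "costima_opt V E p c A k = Max (ic_sigma V E p A ` {S. feasible V E c A k S})"

text \<open>
  Costs may be zero, so the quotient is taken in \<^typ>\<open>ereal\<close>: there \<open>x / 0 = \<infinity>\<close> for \<open>x > 0\<close> and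
  \<open>0 / 0 = 0\<close>, whereas division by zero in \<^typ>\<open>real\<close> would rank cost-free edges last.
\<close>

definition gain_ratio ::
  "'v edge set \<Rightarrow> ('v edge \<Rightarrow> real) \<Rightarrow> ('v edge \<Rightarrow> real) \<Rightarrow> 'v set \<Rightarrow> 'v edge set \<Rightarrow> 'v edge \<Rightarrow> ereal"
where
  "gain_ratio E p c A S e = ereal (delta E p A (S \<union> {e}) S) / ereal (c e)"

text \<open>
  \<open>greedy_phase E p c A S b T R\<close>: from the current set \<open>S\<close>, remaining budget \<open>b\<close> and candidate set
  \<open>T\<close>, the loop can end with \<open>R\<close>. It is a relation because ties in the maximisation may be broken
  arbitrarily.
\<close>

inductive greedy_phase ::
  "'v edge set \<Rightarrow> ('v edge \<Rightarrow> real) \<Rightarrow> ('v edge \<Rightarrow> real) \<Rightarrow> 'v set \<Rightarrow>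
   'v edge set \<Rightarrow> real \<Rightarrow> 'v edge set \<Rightarrow> 'v edge set \<Rightarrow> bool"
  for E p c A where
  stop: "greedy_phase E p c A S b {} S"
| add: "\<lbrakk>is_arg_max (gain_ratio E p c A S) (\<lambda>e. e \<in> T) e; c e \<le> b;
         greedy_phase E p c A (S \<union> {e}) (b - c e) (T - {e}) R\<rbrakk>
        \<Longrightarrow> greedy_phase E p c A S b T R"
| skip: "\<lbrakk>is_arg_max (gain_ratio E p c A S) (\<lambda>e. e \<in> T) e; \<not> c e \<le> b;
          greedy_phase E p c A S b (T - {e}) R\<rbrakk>
         \<Longrightarrow> greedy_phase E p c A S b T R"

text \<open>
  \<open>algorithm_output V E p c A k M R\<close>: some run of the algorithm returns \<open>R\<close>. The function \<open>compl\<close>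
  records the completed set that the greedy phase produces from each start set. If no start set
  exists, then there is no \<open>S2\<close> and \<open>S1\<close> is returned.
\<close>

definition algorithm_output ::
  "'v set \<Rightarrow> 'v edge set \<Rightarrow> ('v edge \<Rightarrow> real) \<Rightarrow> ('v edge \<Rightarrow> real) \<Rightarrow> 'v set \<Rightarrow> real \<Rightarrow> nat \<Rightarrow>
   'v edge set \<Rightarrow> bool" where
  "algorithm_output V E p c A k M R \<longleftrightarrow>
     (\<exists>S1 compl.
        let starts = {S. feasible V E c A k S \<and> card S = M} in
        is_arg_max (ic_sigma V E p A) (\<lambda>S. feasible V E c A k S \<and> card S < M) S1 \<and>
        (\<forall>S \<in> starts.
           greedy_phase E p c A S (k - sum c S) (candidates V E A - S) (compl S)) \<and>
        (if starts = {} then R = S1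
         else \<exists>S2. is_arg_max (ic_sigma V E p A) (\<lambda>S. S \<in> compl ` starts) S2 \<and>
                is_arg_max (ic_sigma V E p A) (\<lambda>S. S \<in> {S1, S2}) R))"

end

theory Submission imports Defs begin

text \<open>
  The cascade activates exactly the nodes reachable from \<open>A\<close> in a random live-edge graph. Since added
  edges start at seeds, the reachable set is a coverage function of the added edges, so the spread is
  monotone and submodular and \<open>delta\<close> is its marginal gain. Sviridenko's argument then applies: among
  the start sets is the set \<open>Y\<close> of the first \<open>M\<close> elements of an optimal set in greedy order. Up to the
  first rejection of an optimal element the gap to the optimum shrinks exponentially with the budget
  spent, and that rejected element gains at most \<open>f Y / M \<le> f Y / 3 \<le> f Y / e\<close>.
\<close>

section \<open>Monotone submodular functions\<close>

text \<open>Kept general in the order because maximisers are needed both for the real-valued spread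
  and for the \<open>ereal\<close>-valued \<open>gain_ratio\<close>.\<close>

lemma ex_is_arg_max_if_finite:
  fixes g :: "'a \<Rightarrow> 'b :: linorder"
  assumes "finite S" "S \<noteq> {}"
  shows "\<exists>x. is_arg_max g (\<lambda>x. x \<in> S) x"
proof -
  have "Max (g ` S) \<in> g ` S" using assms by (intro Max_in) auto
  then obtain x where "x \<in> S" "g x = Max (g ` S)" by auto
  then have "is_arg_max g (\<lambda>x. x \<in> S) x"
    using assms(1) by (auto simp: is_arg_max_linorder)
  then show ?thesis by blast
qed

locale monotone_submodular =
  fixes U :: "'a set" and f :: "'a set \<Rightarrow> real"
  assumes finite_ground: "finite U"
    and mono: "S \<subseteq> S' \<Longrightarrow> S' \<subseteq> U \<Longrightarrow> f S \<le> f S'"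
    and diminishing: "S \<subseteq> S' \<Longrightarrow> S' \<subseteq> U \<Longrightarrow> e \<in> U \<Longrightarrow> e \<notin> S' \<Longrightarrow>
      f (S' \<union> {e}) - f S' \<le> f (S \<union> {e}) - f S"
begin

lemma gain_nonneg:
  assumes "S \<subseteq> U" "e \<in> U"
  shows "0 \<le> f (S \<union> {e}) - f S"
  using mono[of S "S \<union> {e}"] assms by auto

text \<open>Insert the elements of \<open>W\<close> one at a time: by \<open>diminishing\<close>,
  each then gains no more than it would directly on top of \<open>S\<close>.\<close>

lemma union_le_sum_gains:
  assumes "finite W" "W \<subseteq> U" "S \<subseteq> U" "W \<inter> S = {}"
  shows "f (S \<union> W) - f S \<le> (\<Sum>e\<in>W. f (S \<union> {e}) - f S)"
  using assms
proof (induction W)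
  case empty
  then show ?case by simp
next
  case (insert x W)
  have "f ((S \<union> W) \<union> {x}) - f (S \<union> W) \<le> f (S \<union> {x}) - f S"
    using insert by (intro diminishing) auto
  moreover have "f (S \<union> W) - f S \<le> (\<Sum>e\<in>W. f (S \<union> {e}) - f S)"
    using insert by auto
  moreover have "S \<union> insert x W = (S \<union> W) \<union> {x}" by auto
  ultimately show ?case using insert.hyps by simp
qed

lemma le_sum_gains:
  assumes "X \<subseteq> U" "S \<subseteq> U"
  shows "f X - f S \<le> (\<Sum>e\<in>X - S. f (S \<union> {e}) - f S)"
proof -
  have "f X \<le> f (S \<union> (X - S))"
    using assms by (intro mono) auto
  moreover have "f (S \<union> (X - S)) - f S \<le> (\<Sum>e\<in>X - S. f (S \<union> {e}) - f S)"
    using assms finite_ground by (intro union_le_sum_gains) (auto intro: finite_subset)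
  ultimately show ?thesis by simp
qed

text \<open>\<open>Y\<close> consists of the first \<open>m\<close> elements of \<open>X\<close> in greedy order: each of the \<open>m\<close> steps gained at
  least as much as any leftover element would have, hence at least as much as it still can.\<close>

lemma ex_greedy_prefix:
  assumes "X \<subseteq> U" "m \<le> card X"
  shows "\<exists>Y\<subseteq>X. card Y = m \<and> (\<forall>e\<in>X - Y. real m * (f (Y \<union> {e}) - f Y) \<le> f Y - f {})"
  using assms(2)
proof (induction m)
  case 0
  show ?case by (intro exI[of _ "{}"]) simp
next
  case (Suc m)
  have finX: "finite X" using assms(1) finite_ground finite_subset by blast
  obtain Y where Y: "Y \<subseteq> X" "card Y = m"
    and gains: "\<And>e. e \<in> X - Y \<Longrightarrow> real m * (f (Y \<union> {e}) - f Y) \<le> f Y - f {}"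
    using Suc by auto
  have "X - Y \<noteq> {}"
    using Y Suc.prems by (metis Diff_eq_empty_iff Suc_n_not_le_n subset_antisym)
  then obtain y where y: "y \<in> X - Y"
    and ymax: "\<And>e. e \<in> X - Y \<Longrightarrow> f (Y \<union> {e}) \<le> f (Y \<union> {y})"
    using finX ex_is_arg_max_if_finite[of "X - Y" "\<lambda>e. f (Y \<union> {e})"]
    by (auto simp: is_arg_max_linorder)
  have "real (Suc m) * (f (Y \<union> {y} \<union> {e}) - f (Y \<union> {y})) \<le> f (Y \<union> {y}) - f {}"
    if e: "e \<in> X - (Y \<union> {y})" for e
  proof -
    have dim: "f (Y \<union> {y} \<union> {e}) - f (Y \<union> {y}) \<le> f (Y \<union> {e}) - f Y"
      using e y Y assms(1) by (intro diminishing) auto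
    then have "real m * (f (Y \<union> {y} \<union> {e}) - f (Y \<union> {y})) \<le> real m * (f (Y \<union> {e}) - f Y)"
      by (intro mult_left_mono) auto
    \<comment> \<open>This pays for \<open>m\<close> of the \<open>Suc m\<close> copies of the gain.
      The last copy is paid by the increment \<open>f (Y \<union> {y}) - f Y\<close>, since
      \<open>y\<close> was the best choice.\<close>
    also have "\<dots> \<le> f Y - f {}" using gains e by auto
    finally show ?thesis using dim ymax[of e] e by (simp add: algebra_simps)
  qed
  moreover have "card (Y \<union> {y}) = Suc m"
    using y Y finX by (simp add: finite_subset)
  ultimately show ?case
    using y Y by (intro exI[of _ "Y \<union> {y}"]) auto
qed

text \<open>Together the elements of \<open>X - S\<close> gain at least \<open>f X - f S\<close> at
  cost at most \<open>B\<close>, so the dominating ratio of \<open>e\<close> is at least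
  \<open>(f X - f S) / B\<close>. Adding \<open>e\<close> thus removes a fraction
  \<open>c e / B\<close> of the gap, and \<open>1 - x \<le> exp (- x)\<close>. The cost of
  \<open>e\<close> is compared with \<open>B\<close> rather than with the remaining
  \<open>b\<close>, so that a rejected element is covered too.\<close>

lemma best_ratio_step:
  assumes "X \<subseteq> U" "S \<subseteq> U" "e \<in> U"
    and "sum c (X - S) \<le> B" "0 < c e" "c e \<le> B"
    and ratio: "\<And>x. x \<in> X - S \<Longrightarrow> f (S \<union> {x}) - f S \<le> (f (S \<union> {e}) - f S) / c e * c x"
    and gap: "f X - f S \<le> exp (- (B - b) / B) * D" "0 \<le> D"
  shows "f X - f (S \<union> {e}) \<le> exp (- (B - (b - c e)) / B) * D"
proof -
  define r where "r = (f (S \<union> {e}) - f S) / c e"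
  have r: "0 \<le> r" unfolding r_def using gain_nonneg[of S e] assms by simp
  have "f X - f S \<le> (\<Sum>x\<in>X - S. f (S \<union> {x}) - f S)"
    using assms by (intro le_sum_gains)
  also have "\<dots> \<le> (\<Sum>x\<in>X - S. r * c x)"
    unfolding r_def by (intro sum_mono ratio)
  also have "\<dots> = r * sum c (X - S)" by (simp add: sum_distrib_left)
  also have "\<dots> \<le> r * B" using r assms(4) by (intro mult_left_mono)
  finally have "(f X - f S) * c e \<le> r * B * c e"
    using assms(5) by (intro mult_right_mono) auto
  also have "\<dots> = (f (S \<union> {e}) - f S) * B"
    using assms(5) by (simp add: r_def)
  finally have "(f X - f S) * c e / B \<le> f (S \<union> {e}) - f S"
    using assms(5,6) by (subst pos_divide_le_eq) auto
  then have "f X - f (S \<union> {e}) \<le> (1 - c e / B) * (f X - f S)"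
    by (simp add: algebra_simps diff_divide_distrib)
  also have "\<dots> \<le> (1 - c e / B) * (exp (- (B - b) / B) * D)"
    using assms(5,6) gap by (intro mult_left_mono) auto
  also have "\<dots> \<le> exp (- (c e / B)) * (exp (- (B - b) / B) * D)"
    using exp_ge_add_one_self[of "- (c e / B)"] gap(2) by (intro mult_right_mono) auto
  also have "\<dots> = exp (- (c e / B) + - (B - b) / B) * D"
    by (simp only: exp_add mult.assoc)
  also have "- (c e / B) + - (B - b) / B = - (B - (b - c e)) / B"
    by (simp add: diff_divide_distrib add_divide_distrib)
  finally show ?thesis .
qed

end

section \<open>The greedy phase\<close>

lemma greedy_phase_exists:
  assumes "finite T"
  shows "\<exists>R. greedy_phase E p c A S b T R"
  using assms
proof (induction "card T" arbitrary: S b T)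
  case 0
  then show ?case by (auto intro: greedy_phase.stop)
next
  case (Suc n)
  then obtain e where e: "is_arg_max (gain_ratio E p c A S) (\<lambda>e. e \<in> T) e"
    using ex_is_arg_max_if_finite[of T "gain_ratio E p c A S"] by fastforce
  then have "e \<in> T" by (simp add: is_arg_max_def)
  then have "n = card (T - {e})" "finite (T - {e})" using Suc by auto
  then obtain R1 R2 where
    R1: "greedy_phase E p c A (S \<union> {e}) (b - c e) (T - {e}) R1" and
    R2: "greedy_phase E p c A S b (T - {e}) R2"
    using Suc.hyps(1)[of "T - {e}"] by metis
  show ?case
    using greedy_phase.add[OF e _ R1] greedy_phase.skip[OF e _ R2] by (cases "c e \<le> b") auto
qed

lemma greedy_phase_bounds:
  assumes "greedy_phase E p c A S b T R" "finite S" "S \<inter> T = {}" "0 \<le> b"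
  shows "S \<subseteq> R" "R \<subseteq> S \<union> T" "sum c R \<le> sum c S + b"
proof -
  have "S \<subseteq> R \<and> R \<subseteq> S \<union> T \<and> sum c R \<le> sum c S + b"
    using assms
  proof (induction rule: greedy_phase.induct)
    case (stop S b)
    then show ?case by simp
  next
    case (add S T e b R)
    have "e \<in> T" using add.hyps(1) by (simp add: is_arg_max_def)
    moreover from this have "sum c (S \<union> {e}) = sum c S + c e"
      using add.prems by (subst sum.union_disjoint) auto
    moreover have "S \<union> {e} \<subseteq> R \<and> R \<subseteq> (S \<union> {e}) \<union> (T - {e}) \<and>
        sum c R \<le> sum c (S \<union> {e}) + (b - c e)"
      using add.prems add.hyps(2) by (intro add.IH) auto
    ultimately show ?case by auto
  next
    case (skip S T e b R)
    have "S \<subseteq> R \<and> R \<subseteq> S \<union> (T - {e}) \<and> sum c R \<le> sum c S + b"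
      using skip.prems by (intro skip.IH) auto
    then show ?case by auto
  qed
  then show "S \<subseteq> R" "R \<subseteq> S \<union> T" "sum c R \<le> sum c S + b" by auto
qed

text \<open>Turns the \<open>ereal\<close> comparison into a real one. A free \<open>x\<close> with
  positive gain would have ratio \<infinity>, above the finite ratio of \<open>e\<close>; hence a
  free \<open>x\<close> gains nothing.\<close>

lemma gain_ratio_le_imp:
  assumes "gain_ratio E p c A S x \<le> gain_ratio E p c A S e"
    and "0 < c e" "0 \<le> c x" "0 \<le> delta E p A (S \<union> {x}) S"
  shows "delta E p A (S \<union> {x}) S \<le> delta E p A (S \<union> {e}) S / c e * c x"
proof (cases "c x = 0")
  case True
  then have "ereal (delta E p A (S \<union> {x}) S) * \<infinity> \<le> ereal (delta E p A (S \<union> {e}) S / c e)"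
    using assms(1,2) by (simp add: gain_ratio_def)
  then show ?thesis
    using True assms(4) by (cases "delta E p A (S \<union> {x}) S = 0") auto
next
  case False
  then show ?thesis
    using assms by (simp add: gain_ratio_def field_simps)
qed

text \<open>As long as no element of \<open>X\<close> has been rejected, \<open>X \<subseteq> S \<union> T\<close> and the gap to \<open>f X\<close> decays
  exponentially in the budget spent. At the first rejection of some \<open>e \<in> X\<close>, adding \<open>e\<close> would overrun
  the budget and so would close the gap to a factor \<open>1 / e\<close>; leaving it out costs at most
  \<open>f Y / 3 \<le> f Y / e\<close>. If \<open>B = 0\<close> the exponent is \<open>0\<close> and only free elements can be added.\<close>

lemma greedy_phase_ratio:
  fixes f :: "'v edge set \<Rightarrow> real"
  assumes "monotone_submodular U f"
    and delta: "\<And>S e. S \<subseteq> U \<Longrightarrow> e \<in> U - S \<Longrightarrow> delta E p A (S \<union> {e}) S = f (S \<union> {e}) - f S"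
    and cost: "\<And>e. e \<in> U \<Longrightarrow> 0 \<le> c e"
    and "X \<subseteq> U" "Y \<subseteq> X" and B: "sum c (X - Y) \<le> B"
    and prefix: "\<And>e. e \<in> X - Y \<Longrightarrow> 3 * (f (Y \<union> {e}) - f Y) \<le> f Y"
    and "0 \<le> f Y"
    and "greedy_phase E p c A S b T R"
    and "S \<subseteq> U" "T \<subseteq> U" "S \<inter> T = {}" "Y \<subseteq> S" "X \<subseteq> S \<union> T" "0 \<le> b" "b \<le> B"
    and "f X - f S \<le> exp (- (B - b) / B) * (f X - f Y)"
  shows "(1 - 1 / exp 1) * f X \<le> f R"
proof -
  interpret monotone_submodular U f by fact
  have finU: "finite U" by (rule finite_ground)
  have gap0: "0 \<le> f X - f Y" using mono assms(4,5) by simp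
  have fX: "0 \<le> f X" using gap0 \<open>0 \<le> f Y\<close> by simp
  \<comment> \<open>Missing elements of \<open>X\<close> are still candidates because
    \<open>X \<subseteq> S \<union> T\<close>, so the maximality of \<open>e\<close> over
    \<open>T\<close> applies to them.\<close>
  have ratio: "f (S \<union> {x}) - f S \<le> (f (S \<union> {e}) - f S) / c e * c x"
    if "is_arg_max (gain_ratio E p c A S) (\<lambda>e. e \<in> T) e" "0 < c e" "x \<in> X - S"
      "S \<subseteq> U" "T \<subseteq> U" "S \<inter> T = {}" "X \<subseteq> S \<union> T" for S T e x
  proof -
    have "x \<in> T" using that by blast
    then have "e \<in> T" "x \<in> T" "gain_ratio E p c A S x \<le> gain_ratio E p c A S e"
      using that(1) by (auto simp: is_arg_max_linorder simp del: split_paired_All)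
    then have "delta E p A (S \<union> {x}) S \<le> delta E p A (S \<union> {e}) S / c e * c x"
      using that delta[of S x] gain_nonneg[of S x] cost[of x]
      by (intro gain_ratio_le_imp) auto
    moreover have "e \<in> U - S" "x \<in> U - S" using that \<open>e \<in> T\<close> \<open>x \<in> T\<close> by auto
    ultimately show ?thesis using that delta[of S x] delta[of S e] by simp
  qed
  have rest: "sum c (X - S) \<le> B" if "Y \<subseteq> S" for S
  proof -
    have "sum c (X - S) \<le> sum c (X - Y)"
      using that finU assms(4) cost by (intro sum_mono2) (auto intro: finite_subset)
    then show ?thesis using B by simp
  qed
  from assms(9-) show ?thesis
  proof (induction rule: greedy_phase.induct)
    case (stop S b)
    then have "f X \<le> f S" by (intro mono) auto
    moreover have "(1 - 1 / exp 1) * f X \<le> 1 * f X"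
      using fX by (intro mult_right_mono) auto
    ultimately show ?case by simp
  next
    case (add S T e b R)
    have e: "e \<in> T" using add.hyps(1) by (simp add: is_arg_max_def)
    have ce: "0 \<le> c e" using e add.prems(2) by (intro cost) auto
    have gap: "f X - f (S \<union> {e}) \<le> exp (- (B - (b - c e)) / B) * (f X - f Y)"
    \<comment> \<open>A free edge has no finite ratio to argue with, but it leaves the exponent
      unchanged and by monotonicity cannot widen the gap.\<close>
    proof (cases "c e = 0")
      case True
      then show ?thesis using add.prems(8) gain_nonneg[of S e] e add.prems(1,2) by auto
    next
      case False
      then show ?thesis
        using add.prems e ce add.hyps(1,2) \<open>X \<subseteq> U\<close> gap0 ratio rest
        by (intro best_ratio_step) auto
    qed
    show ?case
      using gap add.prems e ce add.hyps(2) by (intro add.IH) auto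
  next
    case (skip S T e b R)
    have e: "e \<in> T" using skip.hyps(1) by (simp add: is_arg_max_def)
    show ?case
    proof (cases "e \<in> X")
      case False
      then show ?thesis using skip.prems by (intro skip.IH) auto
    next
      case True
      have XY: "e \<in> X - Y" "e \<notin> S" using True e skip.prems by auto
      have "c e \<le> sum c (X - Y)"
        using XY finU assms(4) cost by (intro member_le_sum) (auto intro: finite_subset)
      then have cB: "c e \<le> B" using B by simp
      have c0: "0 < c e" using skip.hyps(2) skip.prems(6) by simp
      have "f X - f (S \<union> {e}) \<le> exp (- (B - (b - c e)) / B) * (f X - f Y)"
        using skip.prems e c0 cB skip.hyps(1) \<open>X \<subseteq> U\<close> gap0 ratio rest
        by (intro best_ratio_step) auto
      also have "\<dots> \<le> exp (- 1) * (f X - f Y)"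
        using skip.hyps(2) c0 cB gap0 by (intro mult_right_mono) (auto simp: field_simps)
      finally have 1: "f X - f (S \<union> {e}) \<le> exp (- 1) * (f X - f Y)" .
      have "f (S \<union> {e}) - f S \<le> f (Y \<union> {e}) - f Y"
        using XY skip.prems assms(4) by (intro diminishing) auto
      then have 2: "3 * (f (S \<union> {e}) - f S) \<le> f Y"
        using prefix[OF XY(1)] by simp
      have "1 / 3 \<le> exp (- 1 :: real)"
        using exp_le by (simp add: exp_minus field_simps)
      then have 3: "f Y / 3 \<le> exp (- 1) * f Y"
        using mult_right_mono[OF _ \<open>0 \<le> f Y\<close>, of "1 / 3" "exp (- 1)"] by simp
      have "f S \<le> f R"
        using greedy_phase_bounds[OF skip.hyps(3)] skip.prems finU
        by (intro mono) (auto intro: finite_subset)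
      \<comment> \<open>The loss \<open>f Y / 3\<close> from omitting \<open>e\<close> is absorbed
        by the term \<open>exp (- 1) * f Y\<close> on the right of the gap bound, so
        \<open>f Y\<close> cancels.\<close>
      then have "f X - exp (- 1) * f X \<le> f R"
        using 1 2 3 by (simp add: algebra_simps)
      then show ?thesis by (simp add: exp_minus field_simps)
    qed
  qed
qed

section \<open>The cascade as reachability in the live-edge graph\<close>

text \<open>Deterministic counterpart of \<open>ic_round\<close>, with the outcomes of all attempts
  fixed in advance by \<open>L\<close>.\<close>

definition live_round :: "'v edge set \<Rightarrow> 'v set \<times> 'v set \<Rightarrow> 'v set \<times> 'v set" where
  "live_round L = (\<lambda>(X, N). (X \<union> (L `` N - X), L `` N - X))"

text \<open>Each new frontier avoids the active set and hence \<open>Z\<close>, so edges leaving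
  \<open>Z\<close> are never examined.\<close>

lemma live_round_funpow_cong:
  assumes "N \<inter> Z = {}" "Z \<subseteq> X" "\<And>u v. u \<notin> Z \<Longrightarrow> (u, v) \<in> L \<longleftrightarrow> (u, v) \<in> L'"
  shows "(live_round L ^^ n) (X, N) = (live_round L' ^^ n) (X, N)"
  using assms(1,2)
proof (induction n arbitrary: X N)
  case 0
  then show ?case by simp
next
  case (Suc n)
  have "L `` N = L' `` N" using Suc.prems(1) assms(3) by blast
  moreover have "(live_round L ^^ n) (X \<union> (L' `` N - X), L' `` N - X) =
      (live_round L' ^^ n) (X \<union> (L' `` N - X), L' `` N - X)"
    using Suc.prems by (intro Suc.IH) auto
  ultimately show ?case
    by (simp add: funpow_Suc_right live_round_def del: funpow.simps)
qed

text \<open>Allows conditioning on the state after the first round before running the remaining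
  ones.\<close>

lemma funpow_bind_pmf:
  fixes r :: "'a \<Rightarrow> 'a pmf"
  shows "((\<lambda>m. bind_pmf m r) ^^ n) m = bind_pmf m (\<lambda>s. ((\<lambda>m. bind_pmf m r) ^^ n) (return_pmf s))"
proof (induction n)
  case 0
  show ?case by (simp add: bind_return_pmf')
next
  case (Suc n)
  have "((\<lambda>m. bind_pmf m r) ^^ Suc n) m = bind_pmf (((\<lambda>m. bind_pmf m r) ^^ n) m) r" by simp
  also have "\<dots> = bind_pmf (bind_pmf m (\<lambda>s. ((\<lambda>m. bind_pmf m r) ^^ n) (return_pmf s))) r"
    by (subst Suc.IH) simp
  finally show ?case by (simp add: bind_assoc_pmf)
qed

text \<open>Deferred decisions: the edges examined in one round start in \<open>N\<close>, whereas all later rounds only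
  examine edges starting outside \<open>X \<supseteq> N\<close>, so their states may be drawn afresh.\<close>

lemma ic_rounds_eq_live_rounds:
  assumes "finite F" "N \<subseteq> X"
  shows "((\<lambda>m. bind_pmf m (ic_round F p)) ^^ n) (return_pmf (X, N)) =
    map_pmf (\<lambda>L. (live_round L ^^ n) (X, N)) (live_edges F p)"
  using assms(2)
proof (induction n arbitrary: X N)
  case 0
  then show ?case by simp
next
  case (Suc n)
  define q where "q = (\<lambda>e. bernoulli_pmf (p e))"
  define lg where "lg = (\<lambda>l :: 'a edge \<Rightarrow> bool. {e \<in> F. l e})"
  define T where "T = {(u, v) \<in> F. u \<in> N \<and> v \<notin> X}"
  define st where "st = (\<lambda>l :: 'a edge \<Rightarrow> bool.
    (X \<union> {v. \<exists>u. (u, v) \<in> T \<and> l (u, v)}, {v. \<exists>u. (u, v) \<in> T \<and> l (u, v)}))"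
  \<comment> \<open>\<open>f\<close> decides the edges examined in the current round,
    \<open>g\<close> all others.\<close>
  define ml where "ml = (\<lambda>f g :: 'a edge \<Rightarrow> bool. \<lambda>x. if x \<in> T then f x else g x)"
  have T: "T \<subseteq> F" "finite T" "finite (F - T)"
    using assms(1) by (auto simp: T_def intro: finite_subset)
  have live: "live_edges F p = map_pmf lg (Pi_pmf F False q)"
    by (simp add: live_edges_def lg_def q_def)
  have split: "Pi_pmf F False q =
      bind_pmf (Pi_pmf T False q) (\<lambda>f. map_pmf (ml f) (Pi_pmf (F - T) False q))"
    using Pi_pmf_union[of T "F - T" False q] T
    by (simp add: ml_def pair_pmf_def map_bind_pmf map_pmf_def[symmetric]
        bind_return_pmf map_pmf_comp case_prod_unfold Un_absorb1)
  have st_live: "live_round (lg (ml f g)) (X, N) = st f" for f g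
    by (auto simp: live_round_def lg_def ml_def st_def T_def)
  have forget: "(live_round (lg (ml f g)) ^^ n) (st f') = (live_round (lg g) ^^ n) (st f')" for f f' g
    unfolding st_def
  proof (rule live_round_funpow_cong[where Z = X])
    show "(u, v) \<in> lg (ml f g) \<longleftrightarrow> (u, v) \<in> lg g" if "u \<notin> X" for u v
      using that Suc.prems by (auto simp: lg_def ml_def T_def)
  qed (auto simp: T_def)
  have "((\<lambda>m. bind_pmf m (ic_round F p)) ^^ Suc n) (return_pmf (X, N)) =
      ((\<lambda>m. bind_pmf m (ic_round F p)) ^^ n) (ic_round F p (X, N))"
    by (simp add: funpow_Suc_right bind_return_pmf del: funpow.simps)
  also have "ic_round F p (X, N) = map_pmf st (Pi_pmf T False q)"
    by (simp add: ic_round_def st_def T_def q_def Let_def)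
  also have "((\<lambda>m. bind_pmf m (ic_round F p)) ^^ n) \<dots> =
      bind_pmf (Pi_pmf T False q)
        (\<lambda>f. ((\<lambda>m. bind_pmf m (ic_round F p)) ^^ n) (return_pmf (st f)))"
    by (subst funpow_bind_pmf) (simp add: bind_map_pmf)
  also have "\<dots> = bind_pmf (Pi_pmf T False q)
      (\<lambda>f. map_pmf (\<lambda>L. (live_round L ^^ n) (st f)) (live_edges F p))"
    by (intro bind_pmf_cong refl) (auto simp: st_def intro!: Suc.IH)
  \<comment> \<open>The induction hypothesis redraws all of \<open>F\<close>, including
    \<open>T\<close>. Here \<open>forget\<close> discards the redrawn values on \<open>T\<close>;
    the next step puts the first-round outcome \<open>f\<close> in their place.\<close>
  also have "\<dots> = bind_pmf (Pi_pmf T False q)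
      (\<lambda>f. map_pmf (\<lambda>g. (live_round (lg g) ^^ n) (st f)) (Pi_pmf (F - T) False q))"
    by (simp add: live split map_bind_pmf map_pmf_comp forget)
  also have "\<dots> = bind_pmf (Pi_pmf T False q)
      (\<lambda>f. map_pmf (\<lambda>g. (live_round (lg (ml f g)) ^^ Suc n) (X, N)) (Pi_pmf (F - T) False q))"
    by (simp add: funpow_Suc_right st_live forget del: funpow.simps)
  also have "\<dots> = map_pmf (\<lambda>L. (live_round L ^^ Suc n) (X, N)) (live_edges F p)"
    by (simp add: live split map_bind_pmf map_pmf_comp del: funpow.simps)
  finally show ?case .
qed

text \<open>Only frontier nodes may have unexamined live edges. Once \<open>N = {}\<close>, the set
  \<open>X\<close> is closed under \<open>L\<close> and therefore equals the reachable set.\<close>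

lemma live_round_invariant:
  assumes "(live_round L ^^ n) (A, A) = (X, N)"
  shows "A \<subseteq> X \<and> N \<subseteq> X \<and> X \<subseteq> L\<^sup>* `` A \<and> L `` (X - N) \<subseteq> X"
  using assms
proof (induction n arbitrary: X N)
  case 0
  then show ?case by auto
next
  case (Suc n)
  obtain X0 N0 where prev: "(live_round L ^^ n) (A, A) = (X0, N0)" by fastforce
  have "X = X0 \<union> (L `` N0 - X0)" "N = L `` N0 - X0"
    using Suc.prems prev by (auto simp: live_round_def)
  moreover have "L `` N0 \<subseteq> L\<^sup>* `` A"
    using Suc.IH[OF prev] by (blast intro: rtrancl_into_rtrancl)
  ultimately show ?case using Suc.IH[OF prev] by blast
qed

lemma ic_final_eq_reachable:
  assumes "finite V" "F \<subseteq> V \<times> V" "A \<subseteq> V"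
  shows "ic_final V F p A = map_pmf (\<lambda>L. L\<^sup>* `` A) (live_edges F p)"
proof -
  have "finite F" using assms(1,2) finite_subset by blast
  have "ic_state F p A n = ((\<lambda>m. bind_pmf m (ic_round F p)) ^^ n) (return_pmf (A, A))" for n
    by (induction n) auto
  then have state: "ic_state F p A n =
      map_pmf (\<lambda>L. (live_round L ^^ n) (A, A)) (live_edges F p)" for n
    using ic_rounds_eq_live_rounds[OF \<open>finite F\<close>] by simp
  have "fst ((live_round L ^^ card V) (A, A)) = L\<^sup>* `` A" if "L \<in> set_pmf (live_edges F p)" for L
  proof -
    obtain X N where XN: "(live_round L ^^ card V) (A, A) = (X, N)" by fastforce
    \<comment> \<open>The deterministic run lies in the support of the cascade, so the stopping
      lemma for the cascade applies to it.\<close>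
    then have "(X, N) \<in> set_pmf (ic_state F p A (card V))"
      using that by (force simp: state)
    then have "N = {}" by (rule ic_state_stopped[OF assms])
    with live_round_invariant[OF XN] have "A \<subseteq> X" "X \<subseteq> L\<^sup>* `` A" "L `` X \<subseteq> X" by auto
    moreover from this have "L\<^sup>* `` A \<subseteq> X"
      using Image_closed_trancl[of L X] by blast
    ultimately show ?thesis using XN by simp
  qed
  then show ?thesis
    by (auto simp: ic_final_def state map_pmf_comp intro!: map_pmf_cong)
qed

section \<open>The influence spread as expected coverage\<close>

text \<open>One sample \<open>L\<close> serves all \<open>S\<close>: cutting it down to
  \<open>E \<union> S\<close> couples the live-edge graphs, so spreads can be compared sample by
  sample.\<close>

definition spread :: "'v edge set \<Rightarrow> 'v set \<Rightarrow> 'v edge set \<Rightarrow> 'v edge set \<Rightarrow> 'v set" where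
  "spread E A L S = (L \<inter> (E \<union> S))\<^sup>* `` A"

text \<open>Added edges start at seeds, so a path from \<open>A\<close> needs at most one of them, namely as its first
  edge: the spread is a coverage function of the added edges.\<close>

lemma spread_eq_coverage:
  assumes "S \<subseteq> A \<times> V"
  shows "spread E A L S = (L \<inter> E)\<^sup>* `` A \<union> (\<Union>e\<in>S. if e \<in> L then (L \<inter> E)\<^sup>* `` {snd e} else {})"
    (is "_ = ?C")
proof
  \<comment> \<open>Closure suffices, as \<open>A \<subseteq> ?C\<close>. A live added edge leads to
    its own head, which starts that edge's own term of the union, from whichever \<open>v\<close> it
    was reached.\<close>
  have "(L \<inter> (E \<union> S)) `` ?C \<subseteq> ?C"
  proof
    fix w assume "w \<in> (L \<inter> (E \<union> S)) `` ?C"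
    then obtain v where v: "v \<in> ?C" "(v, w) \<in> L" "(v, w) \<in> E \<or> (v, w) \<in> S" by blast
    show "w \<in> ?C"
    proof (cases "(v, w) \<in> S")
      case True
      then show ?thesis using v(2) by (intro UnI2 UN_I[of "(v, w)"]) auto
    next
      case False
      then have "(v, w) \<in> L \<inter> E" using v by blast
      with v(1) show ?thesis
        by (auto split: if_splits intro: rtrancl_into_rtrancl)
    qed
  qed
  then have "(L \<inter> (E \<union> S))\<^sup>* `` ?C = ?C" by (rule Image_closed_trancl)
  moreover have "A \<subseteq> ?C" by blast
  ultimately show "spread E A L S \<subseteq> ?C"
    unfolding spread_def by blast
next
  have mono: "(L \<inter> E)\<^sup>* \<subseteq> (L \<inter> (E \<union> S))\<^sup>*" by (intro rtrancl_mono) auto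
  have "(L \<inter> E)\<^sup>* `` {snd e} \<subseteq> spread E A L S" if "e \<in> S" "e \<in> L" for e
  proof
    fix w assume "w \<in> (L \<inter> E)\<^sup>* `` {snd e}"
    then have "(snd e, w) \<in> (L \<inter> (E \<union> S))\<^sup>*" using mono by auto
    moreover have "(fst e, snd e) \<in> L \<inter> (E \<union> S)" using that by simp
    ultimately have "(fst e, w) \<in> (L \<inter> (E \<union> S))\<^sup>*" by (rule converse_rtrancl_into_rtrancl[rotated])
    moreover have "fst e \<in> A" using that assms by auto
    ultimately show "w \<in> spread E A L S" by (auto simp: spread_def)
  qed
  moreover have "(L \<inter> E)\<^sup>* `` A \<subseteq> spread E A L S"
    unfolding spread_def using mono by (intro Image_mono) auto
  ultimately show "?C \<subseteq> spread E A L S"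
    by (intro Un_least UN_least) simp_all
qed

lemma spread_subset:
  assumes "E \<subseteq> V \<times> V" "S \<subseteq> V \<times> V" "A \<subseteq> V"
  shows "spread E A L S \<subseteq> V"
proof -
  have "(L \<inter> (E \<union> S))\<^sup>* `` V = V"
    using assms by (intro Image_closed_trancl) auto
  then show ?thesis using assms(3) unfolding spread_def by blast
qed

lemma spread_mono: "S \<subseteq> S' \<Longrightarrow> spread E A L S \<subseteq> spread E A L S'"
  unfolding spread_def by (intro Image_mono rtrancl_mono) auto

text \<open>By the coverage formula \<open>e\<close> contributes the same set \<open>C\<close> to
  every spread; a larger spread already contains more of it.\<close>

lemma card_spread_diminishing:
  assumes "finite V" "E \<subseteq> V \<times> V" "A \<subseteq> V" "S \<subseteq> S'" "S' \<subseteq> A \<times> V" "e \<in> A \<times> V"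
  shows "real (card (spread E A L (S' \<union> {e}))) - real (card (spread E A L S')) \<le>
    real (card (spread E A L (S \<union> {e}))) - real (card (spread E A L S))"
proof -
  define C where "C = (if e \<in> L then (L \<inter> E)\<^sup>* `` {snd e} else {})"
  have gain: "real (card (spread E A L (W \<union> {e}))) - real (card (spread E A L W)) =
      real (card (C - spread E A L W)) \<and> finite C" if "W \<subseteq> A \<times> V" for W
  proof -
    have un: "spread E A L (W \<union> {e}) = spread E A L W \<union> C"
      using that assms(6)
      by (subst (1 2) spread_eq_coverage[where V = V]) (auto simp: C_def)
    have "spread E A L (W \<union> {e}) \<subseteq> V"
      using that assms by (intro spread_subset) auto
    then have fin: "finite (spread E A L W)" "finite C"
      using assms(1) un by (auto intro: finite_subset)
    have "card (spread E A L W \<union> (C - spread E A L W)) =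
        card (spread E A L W) + card (C - spread E A L W)"
      using fin by (intro card_Un_disjoint) auto
    then show ?thesis using un fin by simp
  qed
  have "C - spread E A L S' \<subseteq> C - spread E A L S"
    using spread_mono[OF assms(4)] by blast
  then have "card (C - spread E A L S') \<le> card (C - spread E A L S)"
    using gain[of S] assms(4,5) by (intro card_mono) auto
  then show ?thesis using gain[of S] gain[of S'] assms(4,5) by simp
qed

lemma finite_set_pmf_live_edges:
  assumes "finite F"
  shows "finite (set_pmf (live_edges F p))"
proof -
  have "set_pmf (live_edges F p) \<subseteq> Pow F" by (auto simp: live_edges_def)
  then show ?thesis using assms by (simp add: finite_subset)
qed

text \<open>Edges are live independently, so ignoring the coordinates outside \<open>F'\<close>
  leaves the product over \<open>F'\<close>.\<close>

lemma live_edges_restrict: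
  assumes "finite F" "F' \<subseteq> F"
  shows "live_edges F' p = map_pmf (\<lambda>L. L \<inter> F') (live_edges F p)"
  using assms
  by (auto simp: live_edges_def Pi_pmf_subset[OF assms] map_pmf_comp intro!: map_pmf_cong)

lemma ic_sigma_nonneg: "0 \<le> ic_sigma V E p A S"
  unfolding ic_sigma_def by (intro integral_nonneg_AE) simp

section \<open>Expected spread over one common random live-edge graph\<close>

context
  fixes V A :: "'v set" and E :: "'v edge set" and p :: "'v edge \<Rightarrow> real"
  assumes finV: "finite V" and EV: "E \<subseteq> V \<times> V" and AV: "A \<subseteq> V"
begin

private abbreviation (input) "U \<equiv> candidates V E A"
private abbreviation (input) "D \<equiv> live_edges (E \<union> U) p"

private lemma U: "U \<subseteq> A \<times> V" "U \<subseteq> V \<times> V" "finite U" "finite (E \<union> U)"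
proof -
  show "U \<subseteq> A \<times> V" and *: "U \<subseteq> V \<times> V" using AV by (auto simp: candidates_def)
  have "finite (V \<times> V)" using finV by simp
  then show "finite U" "finite (E \<union> U)" using * EV by (auto intro: finite_subset)
qed

private lemma integrable_D: "integrable (measure_pmf D) (g :: _ \<Rightarrow> real)"
  using U(4) by (intro integrable_measure_pmf_finite finite_set_pmf_live_edges)

lemma ic_sigma_eq_expected_spread:
  assumes "S \<subseteq> U"
  shows "ic_sigma V E p A S = measure_pmf.expectation D (\<lambda>L. real (card (spread E A L S)))"
proof -
  have "ic_final V (E \<union> S) p A = map_pmf (\<lambda>L. L\<^sup>* `` A) (live_edges (E \<union> S) p)"
    using assms U EV finV AV by (intro ic_final_eq_reachable) auto
  also have "\<dots> = map_pmf (\<lambda>L. spread E A L S) D"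
    using assms U by (subst live_edges_restrict[of "E \<union> U"]) (auto simp: map_pmf_comp spread_def)
  finally show ?thesis by (simp add: ic_sigma_def)
qed

text \<open>As \<open>e\<close> lies neither in \<open>E\<close> nor in \<open>S\<close>, deleting
  it leaves exactly the live graph for \<open>S\<close>. The two reachable sets are nested, so the
  size of their difference is the difference of their sizes.\<close>

lemma delta_eq_gain:
  assumes "S \<subseteq> U" "e \<in> U - S"
  shows "delta E p A (S \<union> {e}) S = ic_sigma V E p A (S \<union> {e}) - ic_sigma V E p A S"
proof -
  have card: "real (card ((L \<inter> (E \<union> (S \<union> {e})))\<^sup>* `` A - (L \<inter> (E \<union> (S \<union> {e})) - (S \<union> {e} - S))\<^sup>* `` A)) =
      real (card (spread E A L (S \<union> {e}))) - real (card (spread E A L S))" for L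
  proof -
    have "L \<inter> (E \<union> (S \<union> {e})) - (S \<union> {e} - S) = L \<inter> (E \<union> S)"
      using assms by (auto simp: candidates_def)
    moreover have "spread E A L S \<subseteq> spread E A L (S \<union> {e})" by (intro spread_mono) auto
    moreover have "finite (spread E A L (S \<union> {e}))"
      using assms U EV AV finV
      by (intro finite_subset[OF spread_subset[of E V "S \<union> {e}" A L]]) auto
    ultimately show ?thesis
      by (simp add: spread_def card_Diff_subset card_mono finite_subset of_nat_diff)
  qed
  have "delta E p A (S \<union> {e}) S = measure_pmf.expectation D
      (\<lambda>L. real (card (spread E A L (S \<union> {e}))) - real (card (spread E A L S)))"
    unfolding delta_def card[symmetric]
    using assms U by (subst live_edges_restrict[of "E \<union> U"]) auto
  also have "\<dots> = ic_sigma V E p A (S \<union> {e}) - ic_sigma V E p A S"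
    using assms by (simp add: ic_sigma_eq_expected_spread integrable_D)
  finally show ?thesis .
qed

lemma monotone_submodular_ic_sigma: "monotone_submodular U (ic_sigma V E p A)"
proof
  show "finite U" by (rule U)
next
  fix S S' assume S: "S \<subseteq> S'" "S' \<subseteq> U"
  have "card (spread E A L S) \<le> card (spread E A L S')" for L
    using S U EV AV finV
    by (intro card_mono spread_mono finite_subset[OF spread_subset[of E V S' A L]]) auto
  then show "ic_sigma V E p A S \<le> ic_sigma V E p A S'"
    using S by (auto simp: ic_sigma_eq_expected_spread intro!: integral_mono integrable_D)
next
  fix S S' e assume S: "S \<subseteq> S'" "S' \<subseteq> U" "e \<in> U" "e \<notin> S'"
  have "measure_pmf.expectation D
      (\<lambda>L. real (card (spread E A L (S' \<union> {e}))) - real (card (spread E A L S'))) \<le>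
    measure_pmf.expectation D
      (\<lambda>L. real (card (spread E A L (S \<union> {e}))) - real (card (spread E A L S)))"
    using S U finV EV AV
    by (intro integral_mono integrable_D card_spread_diminishing[where V = V]) auto
  then show "ic_sigma V E p A (S' \<union> {e}) - ic_sigma V E p A S' \<le>
      ic_sigma V E p A (S \<union> {e}) - ic_sigma V E p A S"
    using S by (simp add: ic_sigma_eq_expected_spread integrable_D)
qed

end

section \<open>Existence of a run, feasibility and the approximation ratio\<close>

theorem theorem10:
  fixes V A :: "'v set" and E :: "('v \<times> 'v) set"
    and p c :: "'v \<times> 'v \<Rightarrow> real" and k :: real and M :: nat
  assumes "finite V" and "E \<subseteq> V \<times> V"
    and "\<forall>e \<in> V \<times> V. 0 \<le> p e \<and> p e \<le> 1"
    and "\<forall>e \<in> V \<times> V. 0 \<le> c e \<and> c e \<le> 1"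
    and "A \<subseteq> V" and "0 \<le> k" and "3 \<le> M"
  shows "(\<exists>S_out. algorithm_output V E p c A k M S_out) \<and>
         (\<forall>S_out. algorithm_output V E p c A k M S_out \<longrightarrow>
            feasible V E c A k S_out \<and>
            ic_sigma V E p A S_out \<ge> (1 - 1 / exp 1) * costima_opt V E p c A k)"
proof -
  define U where "U = candidates V E A"
  define f where "f = ic_sigma V E p A"
  define Fs where "Fs = {S. feasible V E c A k S}"
  define starts where "starts = {S. feasible V E c A k S \<and> card S = M}"
  interpret monotone_submodular U f
    unfolding U_def f_def using assms by (intro monotone_submodular_ic_sigma)
  have finU: "finite U" by (rule finite_ground)
  have cost: "0 \<le> c e" if "e \<in> U" for e
    using that assms(4,5) by (auto simp: U_def candidates_def)
  have fnn: "0 \<le> f S" for S unfolding f_def by (rule ic_sigma_nonneg)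
  have Fs: "finite Fs" "{} \<in> Fs"
    using finU assms(6) finite_subset[of Fs "Pow U"] by (auto simp: Fs_def feasible_def U_def)
  have starts: "finite starts" using Fs(1) by (rule rev_finite_subset) (auto simp: starts_def Fs_def)
  have run: "feasible V E c A k R"
    if "S \<in> starts" "greedy_phase E p c A S (k - sum c S) (candidates V E A - S) R" for S R
  proof -
    have S: "S \<subseteq> U" "sum c S \<le> k" using that(1) by (auto simp: starts_def feasible_def U_def)
    then have "finite S" using finU finite_subset by blast
    with greedy_phase_bounds[OF that(2)] S show ?thesis
      by (auto simp: feasible_def U_def)
  qed
  have ex: "\<exists>R. algorithm_output V E p c A k M R"
  proof -
    have "finite {S. feasible V E c A k S \<and> card S < M}" "{} \<in> {S. feasible V E c A k S \<and> card S < M}"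
      using Fs assms(7) by (auto simp: Fs_def)
    then obtain S1 where S1: "is_arg_max f (\<lambda>S. feasible V E c A k S \<and> card S < M) S1"
      using ex_is_arg_max_if_finite[of "{S. feasible V E c A k S \<and> card S < M}" f]
      unfolding mem_Collect_eq by blast
    have "\<forall>S. \<exists>R. greedy_phase E p c A S (k - sum c S) (candidates V E A - S) R"
      using finU by (auto simp: U_def intro!: greedy_phase_exists)
    then obtain compl where compl:
      "\<And>S. greedy_phase E p c A S (k - sum c S) (candidates V E A - S) (compl S)" by metis
    show ?thesis
    proof (cases "starts = {}")
      case True
      then show ?thesis
        using S1 compl by (auto simp: algorithm_output_def Let_def starts_def f_def)
    next
      case False
      then obtain S2 where S2: "is_arg_max f (\<lambda>S. S \<in> compl ` starts) S2"
        using starts ex_is_arg_max_if_finite[of "compl ` starts" f] by auto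
      obtain R where R: "is_arg_max f (\<lambda>S. S \<in> {S1, S2}) R"
        using ex_is_arg_max_if_finite[of "{S1, S2}" f] by auto
      show ?thesis
        unfolding algorithm_output_def Let_def starts_def[symmetric] f_def[symmetric]
        using S1 S2 R compl False by (metis (no_types, lifting))
    qed
  qed
  have bound: "feasible V E c A k R \<and> (1 - 1 / exp 1) * costima_opt V E p c A k \<le> f R"
    if alg: "algorithm_output V E p c A k M R" for R
  proof -
    obtain S1 compl where
      S1: "is_arg_max f (\<lambda>S. feasible V E c A k S \<and> card S < M) S1"
      and compl: "\<And>S. S \<in> starts \<Longrightarrow>
        greedy_phase E p c A S (k - sum c S) (candidates V E A - S) (compl S)"
      and R: "if starts = {} then R = S1
         else \<exists>S2. is_arg_max f (\<lambda>S. S \<in> compl ` starts) S2 \<and> is_arg_max f (\<lambda>S. S \<in> {S1, S2}) R"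
      using alg unfolding algorithm_output_def Let_def starts_def[symmetric] f_def[symmetric]
      by blast
    have feas: "feasible V E c A k R"
      using S1 R run compl by (auto simp: is_arg_max_linorder split: if_splits)
    have R1: "f S1 \<le> f R"
      using R by (auto simp: is_arg_max_linorder split: if_splits)
    have R2: "f (compl S) \<le> f R" if S: "S \<in> starts" for S
    proof -
      obtain S2 where "is_arg_max f (\<lambda>S. S \<in> compl ` starts) S2" "is_arg_max f (\<lambda>S. S \<in> {S1, S2}) R"
        using R S by (auto split: if_splits)
      then have "f (compl S) \<le> f S2" "f S2 \<le> f R"
        using S by (simp_all add: is_arg_max_linorder)
      then show ?thesis by simp
    qed
    have "costima_opt V E p c A k \<in> f ` Fs"
      unfolding costima_opt_def f_def[symmetric] Fs_def[symmetric]
      using Fs by (intro Max_in) auto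
    then obtain X where X: "X \<in> Fs" "costima_opt V E p c A k = f X" by auto
    have XU: "X \<subseteq> U" "sum c X \<le> k" using X by (auto simp: Fs_def feasible_def U_def)
    have finX: "finite X" using XU finU finite_subset by blast
    have "(1 - 1 / exp 1) * f X \<le> f R"
    \<comment> \<open>A small optimum competes directly in the enumeration for \<open>S1\<close>; a
      large one contains a start set.\<close>
    proof (cases "card X < M")
      case True
      then have "f X \<le> f S1" using S1 X by (auto simp: is_arg_max_linorder Fs_def)
      moreover have "(1 - 1 / exp 1) * f X \<le> 1 * f X"
        using fnn by (intro mult_right_mono) auto
      ultimately show ?thesis using R1 by simp
    next
      case False
      then obtain Y where Y: "Y \<subseteq> X" "card Y = M"
        and prefix: "\<And>e. e \<in> X - Y \<Longrightarrow> real M * (f (Y \<union> {e}) - f Y) \<le> f Y - f {}"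
        using ex_greedy_prefix[OF XU(1), of M] by auto
      have split: "sum c X = sum c (X - Y) + sum c Y"
        using Y(1) finX by (rule sum.subset_diff)
      have "0 \<le> sum c (X - Y)" using XU(1) cost by (intro sum_nonneg) auto
      then have kY: "sum c Y \<le> k" using split XU(2) by simp
      then have start: "Y \<in> starts" using Y XU by (auto simp: starts_def feasible_def U_def)
      have "3 * (f (Y \<union> {e}) - f Y) \<le> f Y" if "e \<in> X - Y" for e
      proof -
        have "3 * (f (Y \<union> {e}) - f Y) \<le> real M * (f (Y \<union> {e}) - f Y)"
          using assms(7) gain_nonneg[of Y e] that Y XU by (intro mult_right_mono) auto
        then show ?thesis using prefix[OF that] fnn[of "{}"] by simp
      qed
      then have "(1 - 1 / exp 1) * f X \<le> f (compl Y)"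
        \<comment> \<open>The run from \<open>Y\<close> starts with \<open>b = B\<close>, so the
          factor is \<open>exp 0 = 1\<close> and the initial gap bound is an equality.\<close>
        using compl[OF start] Y XU split kY fnn cost delta_eq_gain[OF assms(1,2,5)]
        by (intro greedy_phase_ratio[OF monotone_submodular_axioms, where B = "k - sum c Y" and
              b = "k - sum c Y" and S = Y and T = "U - Y" and X = X and Y = Y])
          (auto simp: f_def U_def)
      then show ?thesis using R2[OF start] by simp
    qed
    then show ?thesis using feas X(2) by simp
  qed
  show ?thesis using ex bound by (auto simp: f_def)
qed

end
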